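(* Let $G$ and $H$ be two nontrivial and connected graphs. (Even) If at least one of $G$ and $H$ is even, then the strong product $G\boxtimes H$ is equimatchable if and only if $\alpha(G)+\alpha(H)=2$. (Odd) If both $G$ and $H$ are odd, then $G\boxtimes H$ is equimatchable if and only if $\alpha(G)+\alpha(H)\leq 3$.
   Context: All graphs are finite and simple. A graph is trivial if it has exactly one vertex; nontrivial graphs have at least two vertices. An odd (resp. even) graph is a graph with an odd (resp. even) number of vertices. $\alpha(G)$ is the independence number of $G$, i.e., the maximum cardinality of a set of pairwise nonadjacent vertices. A matching is a set of edges no two of which share an endpoint. A graph is equimatchable if all its (inclusion-wise) maximal matchings are maximum, i.e., of largest cardinality among all matchings. The strong product $G\boxtimes H$ has vertex set $V(G)\times V(H)$, and two distinct vertices $(u_1,v_1)$ and $(u_2,v_2)$ are adjacent if and only if $u_2\in N_G[u_1]$ and $v_2\in N_H[v_1]$, where $N_G[v]$ denotes the closed neighborhood of $v$ in $G$ (the vertex $v$ together with its neighbors). *)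

theory Defs
  imports "Graph_Theory.Graph_Theory"
begin

text \<open>Finite simple graphs are the library's \<open>pair_graph\<close>s: finite, loop-free, symmetric
  digraphs whose arcs are ordered pairs. An undirected edge between \<open>u\<close> and \<open>v\<close> thus appears
  as the two arcs \<open>(u, v)\<close> and \<open>(v, u)\<close>; matchings have to be built from the unordered edges,
  since otherwise a single edge could contribute twice to the size of a matching.\<close>

definition edges :: "'a pair_pre_digraph \<Rightarrow> 'a set set" where
  "edges G = {{u, v} | u v. (u, v) \<in> parcs G}"

definition nontrivial :: "'a pair_pre_digraph \<Rightarrow> bool" where
  "nontrivial G \<longleftrightarrow> card (pverts G) \<ge> 2"

definition even_graph :: "'a pair_pre_digraph \<Rightarrow> bool" where
  "even_graph G \<longleftrightarrow> even (card (pverts G))"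

definition odd_graph :: "'a pair_pre_digraph \<Rightarrow> bool" where
  "odd_graph G \<longleftrightarrow> odd (card (pverts G))"

definition independent_set :: "'a pair_pre_digraph \<Rightarrow> 'a set \<Rightarrow> bool" where
  "independent_set G S \<longleftrightarrow> S \<subseteq> pverts G \<and> (\<forall>u\<in>S. \<forall>v\<in>S. (u, v) \<notin> parcs G)"

definition independence_number :: "'a pair_pre_digraph \<Rightarrow> nat" where
  "independence_number G = Max {card S | S. independent_set G S}"

definition matching :: "'a pair_pre_digraph \<Rightarrow> 'a set set \<Rightarrow> bool" where
  "matching G M \<longleftrightarrow> M \<subseteq> edges G \<and> (\<forall>e\<in>M. \<forall>f\<in>M. e \<noteq> f \<longrightarrow> e \<inter> f = {})"

definition maximal_matching :: "'a pair_pre_digraph \<Rightarrow> 'a set set \<Rightarrow> bool" where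
  "maximal_matching G M \<longleftrightarrow> matching G M \<and> \<not> (\<exists>M'. matching G M' \<and> M \<subset> M')"

definition maximum_matching :: "'a pair_pre_digraph \<Rightarrow> 'a set set \<Rightarrow> bool" where
  "maximum_matching G M \<longleftrightarrow> matching G M \<and> (\<forall>M'. matching G M' \<longrightarrow> card M' \<le> card M)"

definition equimatchable :: "'a pair_pre_digraph \<Rightarrow> bool" where
  "equimatchable G \<longleftrightarrow> (\<forall>M. maximal_matching G M \<longrightarrow> maximum_matching G M)"

definition closed_neighborhood :: "'a pair_pre_digraph \<Rightarrow> 'a \<Rightarrow> 'a set" where
  "closed_neighborhood G v = insert v {u. (v, u) \<in> parcs G}"

definition strong_product ::
  "'a pair_pre_digraph \<Rightarrow> 'b pair_pre_digraph \<Rightarrow> ('a \<times> 'b) pair_pre_digraph" where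
  "strong_product G H =
    \<lparr> pverts = pverts G \<times> pverts H,
      parcs = {((u1, v1), (u2, v2)) | u1 v1 u2 v2.
        (u1, v1) \<in> pverts G \<times> pverts H \<and> (u2, v2) \<in> pverts G \<times> pverts H \<and>
        (u1, v1) \<noteq> (u2, v2) \<and>
        u2 \<in> closed_neighborhood G u1 \<and> v2 \<in> closed_neighborhood H v1} \<rparr>"

lemma pair_graph_strong_product:
  assumes "pair_graph G" "pair_graph H"
  shows "pair_graph (strong_product G H)"
proof -
  interpret G: pair_graph G by fact
  interpret H: pair_graph H by fact
  have "finite (parcs (strong_product G H))"
    by (rule finite_subset[of _ "(pverts G \<times> pverts H) \<times> (pverts G \<times> pverts H)"])
       (auto simp: strong_product_def)
  moreover have "sym (parcs (strong_product G H))"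
    by (auto simp: strong_product_def closed_neighborhood_def sym_def
        intro: G.arcs_symmetric H.arcs_symmetric)
  ultimately show ?thesis
    by unfold_locales (auto simp: strong_product_def symmetric_def)
qed

end

theory Submission
  imports Defs "HOL-Library.Disjoint_Sets"
begin

text \<open>A maximal matching of \<open>G \<boxtimes> H\<close> leaves an independent set \<open>U\<close> unmatched. If \<open>G\<close> is complete, then
\<open>U\<close> projects injectively onto an independent set of \<open>H\<close>, so \<open>\<bar>U\<bar> \<le> \<alpha>(H)\<close>. When \<open>\<alpha>(H) = 1\<close>, or when
\<open>\<alpha>(H) = 2\<close> and the product is odd, at most one vertex is unmatched and the matching is maximum
(\<open>equimatchable_if_complete_factor\<close>).

For the converse, call a vertex missable if some maximum matching misses it, and essential
otherwise. In a connected equimatchable graph that has a missable vertex, the essential vertices form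
an independent set (\<open>essential_independent\<close>). If moreover the neighbourhood of each vertex is
connected, then an essential vertex would contradict Gallai's lemma applied after its deletion, so
all vertices are missable and Gallai's lemma leaves at most one vertex unmatched
(\<open>misses_at_most_one\<close>). A strong product of nontrivial connected graphs is connected with connected
neighbourhoods. Hence an equimatchable product has a perfect matching if it is even and a matching
that misses exactly one vertex if it is odd.

Now let \<open>x - y - z\<close> be an induced path of \<open>G\<close> and \<open>u - k\<close> an edge of \<open>H\<close>, and consider in the product
the path \<open>a = (x, u)\<close>, \<open>b = (x, k)\<close>, \<open>c = (y, k)\<close>, \<open>d = (z, u)\<close>, where \<open>a\<close> and \<open>d\<close> are nonadjacent. A
maximum matching \<open>K\<close> of the rest of the product may be completed by \<open>ab\<close> and \<open>cd\<close>, or by \<open>bc\<close> only.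
The second matching is too small to be maximal, so \<open>K\<close> misses a neighbour of \<open>a\<close> or of \<open>d\<close>
(\<open>path_blocks\<close>). In the even case there is no missed vertex, so both factors are complete. In
the odd case the single missed vertex must be adjacent to \<open>a\<close> or \<open>d\<close>. The rest of the product is
equimatchable, odd and connected, so every edge in it has a missable end; thus each of its edges has
an end adjacent to \<open>a\<close> or \<open>d\<close> (\<open>near_perfect_no_robust_path\<close>). The path can be chosen so that this
fails: if both factors are incomplete, take \<open>u\<close> with a nonneighbour \<open>h0\<close> and an edge in the row of
\<open>h0\<close>; if \<open>\<alpha>(G) \<ge> 3\<close>, choose the induced path so that some vertex \<open>i\<close> is adjacent to neither \<open>x\<close> nor
\<open>z\<close> and take an edge in the column of \<open>i\<close>.\<close>
section \<open>Matchings, missable vertices and Gallai's lemma\<close>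

text \<open>The matching theory is developed for families of two-element sets instead of graphs, because deleting
vertices then amounts to restricting the family.\<close>

definition matching_in :: "'v set set \<Rightarrow> 'v set set \<Rightarrow> bool" where
  "matching_in E M \<longleftrightarrow> M \<subseteq> E \<and> disjoint M"

definition maximum_in :: "'v set set \<Rightarrow> 'v set set \<Rightarrow> bool" where
  "maximum_in E M \<longleftrightarrow> matching_in E M \<and> (\<forall>K. matching_in E K \<longrightarrow> card K \<le> card M)"

text \<open>For a matching this is inclusion-maximality, see \<open>maximal_matching_iff\<close>.\<close>

definition meets_all :: "'v set set \<Rightarrow> 'v set set \<Rightarrow> bool" where
  "meets_all E M \<longleftrightarrow> (\<forall>e\<in>E. e \<inter> \<Union>M \<noteq> {})"

definition equimatchable_edges :: "'v set set \<Rightarrow> bool" where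
  "equimatchable_edges E \<longleftrightarrow> (\<forall>M. matching_in E M \<and> meets_all E M \<longrightarrow> maximum_in E M)"

definition missable :: "'v set set \<Rightarrow> 'v \<Rightarrow> bool" where
  "missable E v \<longleftrightarrow> (\<exists>M. maximum_in E M \<and> v \<notin> \<Union>M)"

text \<open>The relation of Gallai's lemma; it is an equivalence relation on the missable vertices.\<close>

definition coupled :: "'v set set \<Rightarrow> 'v \<Rightarrow> 'v \<Rightarrow> bool" where
  "coupled E s t \<longleftrightarrow> s = t \<or> (\<forall>M. maximum_in E M \<longrightarrow> s \<in> \<Union>M \<or> t \<in> \<Union>M)"

definition adj :: "'v set set \<Rightarrow> ('v \<times> 'v) set" where
  "adj E = {(u, v). {u, v} \<in> E}"

lemma sym_adj: "sym (adj E)"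
  by (auto simp: adj_def sym_def insert_commute)

lemma Union_minus_matching_edge:
  assumes "disjoint M" "e \<in> M"
  shows "\<Union>(M - {e}) = \<Union>M - e"
  using assms by (auto simp: disjoint_def)

locale edge_family =
  fixes E :: "'v set set"
  assumes finite_edges: "finite E" and card_edge: "e \<in> E \<Longrightarrow> card e = 2"
begin

lemma subfamily: "F \<subseteq> E \<Longrightarrow> edge_family F"
  using finite_edges card_edge by unfold_locales (auto intro: finite_subset)

lemma no_loop: "{v, v} \<notin> E"
  using card_edge[of "{v, v}"] by auto

lemma edge_ends:
  assumes "e \<in> E" "v \<in> e"
  obtains w where "e = {v, w}" "v \<noteq> w"
  using card_edge[OF assms(1)] assms(2) that by (auto simp: card_2_iff)

lemma finite_matching: "matching_in E M \<Longrightarrow> finite M"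
  using finite_edges by (auto simp: matching_in_def intro: finite_subset)

lemma card_matching_le: "matching_in E M \<Longrightarrow> card M \<le> card E"
  using finite_edges by (auto simp: matching_in_def intro: card_mono)

lemma finite_covered: "matching_in E M \<Longrightarrow> finite (\<Union>M)"
  using finite_matching card_edge
  by (metis card.infinite finite_Union matching_in_def subsetD zero_neq_numeral)

lemma card_covered:
  assumes "matching_in E M"
  shows "card (\<Union>M) = 2 * card M"
proof -
  have two: "\<And>e. e \<in> M \<Longrightarrow> card e = 2"
    using assms card_edge by (auto simp: matching_in_def)
  then have "\<And>e. e \<in> M \<Longrightarrow> finite e" by (metis card.infinite zero_neq_numeral)
  then have "card (\<Union>M) = sum card M"
    using assms by (intro card_Union_disjoint) (simp_all add: matching_in_def)
  also have "\<dots> = (\<Sum>e\<in>M. 2)" using two by (intro sum.cong) simp_all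
  finally show ?thesis by simp
qed

lemma mate:
  assumes "matching_in E M" "v \<in> \<Union>M"
  obtains w where "{v, w} \<in> M" "v \<noteq> w" "w \<in> \<Union>M"
proof -
  obtain e where "e \<in> M" "v \<in> e" using assms by blast
  moreover from this obtain w where "e = {v, w}" "v \<noteq> w"
    using assms(1) edge_ends[of e v] by (auto simp: matching_in_def)
  ultimately show thesis using that by blast
qed

lemma mate_unique:
  assumes "matching_in E M" "{v, w} \<in> M" "{v, w'} \<in> M"
  shows "w = w'"
  using assms by (metis disjoint_def disjoint_iff doubleton_eq_iff insertI1 matching_in_def)

lemma maximum_if_card:
  assumes "maximum_in E M" "matching_in E K" "card M \<le> card K"
  shows "maximum_in E K"
  using assms by (meson le_trans maximum_in_def)

lemma matching_insert:
  assumes "matching_in E M" "e \<in> E" "e \<inter> \<Union>M = {}"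
  shows "matching_in E (insert e M)" "card (insert e M) = Suc (card M)"
proof -
  have "e \<noteq> {}" using card_edge[OF assms(2)] by auto
  then have "e \<notin> M" using assms(3) by blast
  then show "card (insert e M) = Suc (card M)"
    using finite_matching[OF assms(1)] by simp
  show "matching_in E (insert e M)"
    using assms by (auto simp: matching_in_def disjoint_def)
qed

lemma maximum_meets_all:
  assumes "maximum_in E M"
  shows "meets_all E M"
  using assms matching_insert by (metis Suc_n_not_le_n maximum_in_def meets_all_def)

lemma matching_remove:
  assumes "matching_in E M"
  shows "matching_in E (M - N)"
  using assms by (auto simp: matching_in_def disjoint_def)

lemma exists_maximum: obtains M where "maximum_in E M"
proof -
  have "matching_in E {}" by (simp add: matching_in_def disjoint_def)
  then show thesis
    using that ex_has_greatest_nat[of "matching_in E" "{}" card "Suc (card E)"] card_matching_le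
    by (auto simp: less_Suc_eq_le maximum_in_def)
qed

text \<open>Rotating an edge: an unmatched neighbour \<open>s\<close> of \<open>w\<close> takes the place of the partner of \<open>w\<close>.\<close>

lemma switch:
  assumes M: "matching_in E M" and m: "{w, w'} \<in> M" and s: "s \<notin> \<Union>M" and e: "{s, w} \<in> E"
  defines "K \<equiv> insert {s, w} (M - {{w, w'}})"
  shows "matching_in E K" "card K = card M" "\<Union>K = insert s (\<Union>M - {w'})"
proof -
  have d: "disjoint M" using M by (simp add: matching_in_def)
  have wE: "{w, w'} \<in> E" using M m by (auto simp: matching_in_def)
  have U: "\<Union>(M - {{w, w'}}) = \<Union>M - {w, w'}"
    by (rule Union_minus_matching_edge[OF d m])
  have ne: "w \<noteq> w'" using wE no_loop[of w] by auto
  have "{s, w} \<inter> \<Union>(M - {{w, w'}}) = {}" unfolding U using s by auto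
  from matching_insert[OF matching_remove[OF M] e this]
  show "matching_in E K" "card K = card M"
    using finite_matching[OF M] m card_Suc_Diff1[of M] by (auto simp: K_def)
  have "w \<in> \<Union>M" using m by auto
  then show "\<Union>K = insert s (\<Union>M - {w'})"
    unfolding K_def using U ne by auto
qed

lemma switch_maximum:
  assumes M: "maximum_in E M" and m: "{w, w'} \<in> M" and s: "s \<notin> \<Union>M" and e: "{s, w} \<in> E"
  shows "maximum_in E (insert {s, w} (M - {{w, w'}}))" "w' \<notin> \<Union>(insert {s, w} (M - {{w, w'}}))"
proof -
  have M': "matching_in E M" using M by (simp add: maximum_in_def)
  note sw = switch[OF M' m s e]
  show "maximum_in E (insert {s, w} (M - {{w, w'}}))"
    using maximum_if_card[OF M sw(1)] sw(2) by simp
  show "w' \<notin> \<Union>(insert {s, w} (M - {{w, w'}}))"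
    unfolding sw(3) using m s by auto
qed

text \<open>The core of Gallai's lemma. If \<open>M\<close> missed both \<open>s\<close> and \<open>t\<close>, choose among the maximum matchings missing
\<open>w\<close> one, \<open>N\<close>, that shares as many edges as possible with \<open>M\<close>. It covers \<open>s\<close> and \<open>t\<close>, so by counting,
\<open>M\<close> covers two vertices that \<open>N\<close> misses, one of which differs from \<open>w\<close>; rotating \<open>N\<close> there to an edge
of \<open>M\<close> contradicts the choice.\<close>

lemma coupled_trans:
  assumes sw: "coupled E s w" and wt: "coupled E w t" and w: "missable E w"
  shows "coupled E s t"
proof (rule ccontr)
  assume "\<not> coupled E s t"
  then obtain M where M: "maximum_in E M" "s \<notin> \<Union>M" "t \<notin> \<Union>M" and st: "s \<noteq> t"
    by (auto simp: coupled_def)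
  have ws: "w \<noteq> s" "w \<noteq> t" using sw wt \<open>\<not> coupled E s t\<close> by auto
  have bound: "card (M \<inter> N) \<le> card M" for N
    using M(1) finite_matching by (auto simp: maximum_in_def intro: card_mono)
  let ?P = "\<lambda>N. maximum_in E N \<and> w \<notin> \<Union>N"
  obtain N0 where N0: "?P N0" using w by (auto simp: missable_def)
  have "\<exists>N. ?P N \<and> (\<forall>K. ?P K \<longrightarrow> card (M \<inter> K) \<le> card (M \<inter> N))"
    by (rule ex_has_greatest_nat[where P = ?P and b = "Suc (card M)", OF N0]) (simp add: bound less_Suc_eq_le)
  then obtain N where N: "maximum_in E N" "w \<notin> \<Union>N"
    and best: "\<And>K. maximum_in E K \<Longrightarrow> w \<notin> \<Union>K \<Longrightarrow> card (M \<inter> K) \<le> card (M \<inter> N)"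
    by blast
  have mM: "matching_in E M" and mN: "matching_in E N"
    using M(1) N(1) by (auto simp: maximum_in_def)
  have c: "s \<in> \<Union>N" "t \<in> \<Union>N"
    using sw wt N ws unfolding coupled_def by blast+
  have "card M = card N" using M(1) N(1) by (simp add: maximum_in_def le_antisym)
  then have "card (\<Union>M) = card (\<Union>N)" using card_covered mM mN by simp
  then have "card (\<Union>M - \<Union>N) = card (\<Union>N - \<Union>M)"
    using finite_covered mM mN
    by (metis card_Diff_subset_Int finite_Int inf_commute)
  moreover have "card {s, t} \<le> card (\<Union>N - \<Union>M)"
    using c M finite_covered[OF mN] by (intro card_mono) auto
  ultimately have "card (\<Union>M - \<Union>N) \<ge> 2" using st by simp
  then have "\<not> \<Union>M - \<Union>N \<subseteq> {w}"
    using card_mono[of "{w}" "\<Union>M - \<Union>N"] by auto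
  then obtain y where y: "y \<in> \<Union>M" "y \<notin> \<Union>N" "y \<noteq> w" by blast
  obtain y1 where y1: "{y, y1} \<in> M" "y \<noteq> y1" using mate[OF mM y(1)] by metis
  have yE: "{y, y1} \<in> E" using y1 mM by (auto simp: matching_in_def)
  then have "y1 \<in> \<Union>N" using maximum_meets_all[OF N(1)] y(2) by (auto simp: meets_all_def)
  then obtain z where z: "{y1, z} \<in> N" "z \<in> \<Union>N" using mate[OF mN] by metis
  let ?N = "insert {y, y1} (N - {{y1, z}})"
  note sN = switch[OF mN z(1) y(2) yE]
  have "maximum_in E ?N" by (rule switch_maximum[OF N(1) z(1) y(2) yE])
  moreover have "w \<notin> \<Union>?N" unfolding sN(3) using N(2) y(3) by auto
  ultimately have "card (M \<inter> ?N) \<le> card (M \<inter> N)" by (rule best)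
  moreover have "{y1, z} \<notin> M"
    using mate_unique[OF mM, of y1 y z] y1(1) z(2) y(2) by (auto simp: insert_commute)
  then have "M \<inter> ?N = insert {y, y1} (M \<inter> N)" using y1 by auto
  moreover have "{y, y1} \<notin> N" using y(2) by auto
  ultimately show False using finite_matching[OF mM] by simp
qed

lemma coupled_along_missable_path:
  assumes "(s, t) \<in> {(u, v). {u, v} \<in> E \<and> missable E u \<and> missable E v}\<^sup>*"
  shows "coupled E s t"
  using assms
proof (induction rule: rtrancl_induct)
  case base
  show ?case by (simp add: coupled_def)
next
  case (step v t)
  then have "coupled E v t"
    using maximum_meets_all by (fastforce simp: coupled_def meets_all_def)
  then show ?case using step coupled_trans by blast
qed

text \<open>Otherwise the partner \<open>w'\<close> could be rotated onto \<open>i\<close>, which would expose \<open>w\<close>.\<close>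

lemma mate_of_essential:
  assumes "maximum_in E M" "\<not> missable E w" "{w, w'} \<in> M" "i \<notin> \<Union>M"
  shows "{i, w'} \<notin> E"
proof
  assume e: "{i, w'} \<in> E"
  have "{w', w} \<in> M" using assms(3) by (simp add: insert_commute)
  from switch_maximum[OF assms(1) this assms(4) e] assms(2) show False
    unfolding missable_def by blast
qed

text \<open>Let \<open>v1\<close> and \<open>v2\<close> be the partners of \<open>w1\<close> and \<open>w2\<close> in a maximum matching that misses \<open>s\<close>. Neither is
adjacent to a missed vertex, nor are they adjacent to each other, since rotating \<open>w1\<close> onto \<open>s\<close> turns
\<open>v1\<close> into a missed vertex. Replacing \<open>w1v1\<close> and \<open>w2v2\<close> by the single edge \<open>w1w2\<close> therefore yields a
smaller maximal matching.\<close>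

lemma adjacent_essential:
  assumes equi: "equimatchable_edges E"
    and w1: "\<not> missable E w1" and w2: "\<not> missable E w2"
    and ww: "{w1, w2} \<in> E" and sw: "{s, w1} \<in> E"
  shows "\<not> missable E s"
proof
  assume "missable E s"
  then obtain M where M: "maximum_in E M" "s \<notin> \<Union>M" by (auto simp: missable_def)
  have mM: "matching_in E M" using M by (simp add: maximum_in_def)
  have "w1 \<in> \<Union>M" "w2 \<in> \<Union>M" using M w1 w2 by (auto simp: missable_def)
  then obtain v1 v2 where v1: "{w1, v1} \<in> M" "w1 \<noteq> v1" and v2: "{w2, v2} \<in> M" "w2 \<noteq> v2"
    using mate[OF mM] by metis
  let ?M1 = "insert {s, w1} (M - {{w1, v1}})"
  have M1: "maximum_in E ?M1" "v1 \<notin> \<Union>?M1"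
    using switch_maximum[OF M(1) v1(1) M(2) sw] by auto
  have ne: "w1 \<noteq> w2" using ww no_loop by fastforce
  have "v1 \<noteq> w2" using M1 w2 unfolding missable_def by blast
  then have ne2: "{w1, v1} \<noteq> {w2, v2}" using ne by (auto simp: doubleton_eq_iff)
  have na: "{v1, v2} \<notin> E"
    by (rule mate_of_essential[OF M1(1) w2 _ M1(2)]) (use v2 ne2 in auto)
  let ?K = "M - {{w1, v1}} - {{w2, v2}}"
  let ?K' = "insert {w1, w2} ?K"
  have mK: "matching_in E ?K" "matching_in E (M - {{w1, v1}})"
    using mM by (auto intro!: matching_remove)
  have UK: "\<Union>?K = \<Union>M - {w1, v1} - {w2, v2}"
    using Union_minus_matching_edge[of "M - {{w1, v1}}" "{w2, v2}"]
      Union_minus_matching_edge[of M "{w1, v1}"] mM mK v1 v2 ne2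
    by (auto simp: matching_in_def)
  have "{w1, w2} \<inter> \<Union>?K = {}" unfolding UK by auto
  note ins = matching_insert[OF mK(1) ww this]
  have cK: "card ?K = card M - 2" "card M \<ge> 2"
  proof -
    have "card {{w1, v1}, {w2, v2}} \<le> card M"
      using v1 v2 finite_matching[OF mM] by (intro card_mono) auto
    then show "card M \<ge> 2" using ne2 by simp
    show "card ?K = card M - 2" using v1 v2 ne2 finite_matching[OF mM] by simp
  qed
  have "meets_all E ?K'"
    unfolding meets_all_def
  proof (intro ballI notI)
    fix e assume e: "e \<in> E" and dis: "e \<inter> \<Union>?K' = {}"
    have "\<Union>?K' = \<Union>?K \<union> {w1, w2}" by auto
    then have "\<Union>M \<subseteq> \<Union>?K' \<union> {v1, v2}" unfolding UK by blast
    then have miss: "p \<notin> \<Union>M \<or> p = v1 \<or> p = v2" if "p \<in> e" for p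
      using dis that by blast
    obtain p q where pq: "e = {p, q}" "p \<noteq> q" using card_edge[OF e] by (auto simp: card_2_iff)
    have m: "{i, v1} \<notin> E" "{i, v2} \<notin> E" if "i \<notin> \<Union>M" for i
      using mate_of_essential[OF M(1) w1 v1(1) that] mate_of_essential[OF M(1) w2 v2(1) that] by auto
    have "p \<in> \<Union>M \<or> q \<in> \<Union>M"
      using maximum_meets_all[OF M(1)] e pq by (auto simp: meets_all_def)
    with miss[of p] miss[of q] pq e m na show False by (auto simp: insert_commute)
  qed
  then have "maximum_in E ?K'" using equi ins(1) by (simp add: equimatchable_edges_def)
  then have "card M \<le> card ?K'" using mM by (simp add: maximum_in_def)
  then show False using ins(2) cK by simp
qed

text \<open>Along a path starting in a missable vertex no two consecutive vertices are essential, because an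
essential vertex with a missable neighbour has only missable neighbours.\<close>

lemma essential_independent:
  assumes equi: "equimatchable_edges E" and s: "missable E s" and st: "(s, t) \<in> (adj E)\<^sup>*"
  shows "missable E t \<or> (\<forall>r. {r, t} \<in> E \<longrightarrow> missable E r)"
  using st
proof (induction rule: rtrancl_induct)
  case base
  then show ?case using s by simp
next
  case (step t t')
  then have tt: "{t, t'} \<in> E" "{t', t} \<in> E" by (auto simp: adj_def insert_commute)
  show ?case
  proof (cases "missable E t")
    case True
    then show ?thesis using adjacent_essential[OF equi, of t' _ t] tt by (metis insert_commute)
  next
    case False
    then show ?thesis using step tt by auto
  qed
qed

text \<open>In the graph without the essential vertex \<open>w\<close>, the maximum matchings are one edge smaller, and every
maximum matching of the whole graph gives one of them by dropping the edge at \<open>w\<close>. So all neighbours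
of \<open>w\<close> are missable there, and one such matching misses both \<open>s\<close> and the former partner of \<open>w\<close>. If
the neighbourhood of \<open>w\<close> were connected, Gallai's lemma would forbid this.\<close>

lemma essential_neighbourhood_disconnected:
  assumes w: "\<not> missable E w" and s: "{s, w} \<in> E" "missable E s"
    and nb: "\<And>r. {r, w} \<in> E \<Longrightarrow> missable E r"
    and conn: "\<And>p q. {p, w} \<in> E \<Longrightarrow> {q, w} \<in> E \<Longrightarrow>
      (p, q) \<in> {(u, v). {u, v} \<in> E \<and> {u, w} \<in> E \<and> {v, w} \<in> E}\<^sup>*"
  shows False
proof -
  let ?F = "{e \<in> E. w \<notin> e}"
  interpret F: edge_family ?F by (rule subfamily) auto
  have red: "maximum_in ?F (M - {{w, v}})" "v \<notin> \<Union>(M - {{w, v}})"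
    if M: "maximum_in E M" and wv: "{w, v} \<in> M" for M v
  proof -
    have mM: "matching_in E M" using M by (simp add: maximum_in_def)
    have U: "\<Union>(M - {{w, v}}) = \<Union>M - {w, v}"
      by (rule Union_minus_matching_edge) (use mM wv in \<open>auto simp: matching_in_def\<close>)
    then show "v \<notin> \<Union>(M - {{w, v}})" by simp
    have mF: "matching_in ?F (M - {{w, v}})"
      using matching_remove[OF mM, of "{{w, v}}"] U by (auto simp: matching_in_def)
    have "card K \<le> card (M - {{w, v}})" if K: "matching_in ?F K" for K
    proof -
      have mK: "matching_in E K" "w \<notin> \<Union>K" using K by (auto simp: matching_in_def)
      then have "\<not> card M \<le> card K"
        using maximum_if_card[OF M] w by (auto simp: missable_def)
      then show ?thesis using wv finite_matching[OF mM] by simp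
    qed
    with mF show "maximum_in ?F (M - {{w, v}})" by (simp add: maximum_in_def)
  qed
  have missF: "missable ?F r" if rw: "{r, w} \<in> E" for r
  proof -
    obtain M where M: "maximum_in E M" "r \<notin> \<Union>M" using nb[OF rw] by (auto simp: missable_def)
    then have "w \<in> \<Union>M" "matching_in E M" using w by (auto simp: missable_def maximum_in_def)
    then obtain v where "{w, v} \<in> M" using mate by metis
    from red(1)[OF M(1) this] M(2) show ?thesis by (auto simp: missable_def)
  qed
  obtain M where M: "maximum_in E M" "s \<notin> \<Union>M" using s by (auto simp: missable_def)
  then have mM: "w \<in> \<Union>M" "matching_in E M" using w by (auto simp: missable_def maximum_in_def)
  then obtain v where v: "{w, v} \<in> M" "v \<in> \<Union>M" using mate by metis
  have vw: "{v, w} \<in> E" using v mM by (auto simp: matching_in_def insert_commute)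
  have "{(u, v). {u, v} \<in> E \<and> {u, w} \<in> E \<and> {v, w} \<in> E}
      \<subseteq> {(u, v). {u, v} \<in> ?F \<and> missable ?F u \<and> missable ?F v}"
    using missF no_loop by auto
  from rtrancl_mono[OF this] conn[OF s(1) vw]
  have "coupled ?F s v" by (intro F.coupled_along_missable_path) blast
  then have "s = v \<or> s \<in> \<Union>(M - {{w, v}}) \<or> v \<in> \<Union>(M - {{w, v}})"
    using red(1)[OF M(1) v(1)] by (auto simp: coupled_def)
  then show False using red(2)[OF M(1) v(1)] M(2) v by auto
qed

text \<open>By \<open>essential_independent\<close>, an essential vertex would have only missable neighbours, which the
connectedness of its neighbourhood excludes.\<close>

lemma all_missable:
  assumes equi: "equimatchable_edges E"
    and conn: "\<And>p q. p \<in> V \<Longrightarrow> q \<in> V \<Longrightarrow> (p, q) \<in> (adj E)\<^sup>*"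
    and loc: "\<And>w p q. {p, w} \<in> E \<Longrightarrow> {q, w} \<in> E \<Longrightarrow>
      (p, q) \<in> {(u, v). {u, v} \<in> E \<and> {u, w} \<in> E \<and> {v, w} \<in> E}\<^sup>*"
    and s: "s \<in> V" "missable E s" and t: "t \<in> V"
  shows "missable E t"
proof (rule ccontr)
  assume nt: "\<not> missable E t"
  then have nb: "\<And>r. {r, t} \<in> E \<Longrightarrow> missable E r"
    using essential_independent[OF equi s(2) conn[OF s(1) t]] by blast
  have "t \<noteq> s" using nt s by auto
  then obtain r where "(r, t) \<in> adj E" using conn[OF s(1) t] by (metis rtranclE)
  then have "{r, t} \<in> E" by (simp add: adj_def)
  then show False using essential_neighbourhood_disconnected[OF nt _ _ nb loc] nb by blast
qed

lemma misses_at_most_one: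
  assumes equi: "equimatchable_edges E" and VE: "\<Union>E \<subseteq> V"
    and conn: "\<And>p q. p \<in> V \<Longrightarrow> q \<in> V \<Longrightarrow> (p, q) \<in> (adj E)\<^sup>*"
    and loc: "\<And>w p q. {p, w} \<in> E \<Longrightarrow> {q, w} \<in> E \<Longrightarrow>
      (p, q) \<in> {(u, v). {u, v} \<in> E \<and> {u, w} \<in> E \<and> {v, w} \<in> E}\<^sup>*"
    and M: "maximum_in E M" and p: "p \<in> V - \<Union>M" and q: "q \<in> V - \<Union>M"
  shows "p = q"
proof -
  have "missable E p" using M p by (auto simp: missable_def)
  then have all: "missable E v" if "v \<in> V" for v
    using all_missable[OF equi conn loc _ _ that] p by blast
  have "adj E \<subseteq> {(u, v). {u, v} \<in> E \<and> missable E u \<and> missable E v}"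
    using all VE by (auto simp: adj_def)
  from rtrancl_mono[OF this] conn[of p q] p q
  have "coupled E p q" by (intro coupled_along_missable_path) blast
  then show ?thesis using M p q by (auto simp: coupled_def)
qed

lemma matching_union:
  assumes N: "matching_in E N" and K: "matching_in {e \<in> E. e \<inter> \<Union>N = {}} K"
  shows "matching_in E (K \<union> N)" "card (K \<union> N) = card K + card N"
proof -
  have "K \<subseteq> {e \<in> E. e \<inter> \<Union>N = {}}" and dj: "disjoint K" "disjoint N" and NE: "N \<subseteq> E"
    using K N by (simp_all add: matching_in_def)
  then have KE: "K \<subseteq> E" and KN: "\<And>e. e \<in> K \<Longrightarrow> e \<inter> \<Union>N = {}" by blast+
  have "disjoint (K \<union> N)" using dj KN by (intro disjoint_union) blast+
  then show "matching_in E (K \<union> N)" using KE NE by (simp add: matching_in_def)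
  have "K \<inter> N = {}"
  proof (rule ccontr)
    assume "K \<inter> N \<noteq> {}"
    then obtain e where "e \<in> K" "e \<in> N" by blast
    with KN[of e] have "e = {}" by blast
    with \<open>e \<in> K\<close> KE card_edge[of e] show False by auto
  qed
  then show "card (K \<union> N) = card K + card N"
    using KE NE finite_edges by (meson card_Un_disjoint finite_subset)
qed

text \<open>A maximal matching of the graph left after removing the ends of \<open>N\<close> becomes maximal in the whole graph
when \<open>N\<close> is added.\<close>

lemma delete_matched:
  assumes equi: "equimatchable_edges E" and N: "matching_in E N"
  defines "F \<equiv> {e \<in> E. e \<inter> \<Union>N = {}}"
  shows "equimatchable_edges F" "\<And>K. maximum_in F K \<Longrightarrow> maximum_in E (K \<union> N)"
proof -
  interpret F: edge_family F by (rule subfamily) (auto simp: F_def)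
  have up: "maximum_in E (K \<union> N)" if K: "matching_in F K" "meets_all F K" for K
  proof -
    have "matching_in E (K \<union> N)" using matching_union[OF N] K by (simp add: F_def)
    moreover have "meets_all E (K \<union> N)"
      using K(2) unfolding meets_all_def F_def by blast
    ultimately show ?thesis using equi by (simp add: equimatchable_edges_def)
  qed
  then show "\<And>K. maximum_in F K \<Longrightarrow> maximum_in E (K \<union> N)"
    using F.maximum_meets_all by (simp add: maximum_in_def)
  show "equimatchable_edges F"
    unfolding equimatchable_edges_def
  proof (intro allI impI)
    fix K assume "matching_in F K \<and> meets_all F K"
    then have K: "matching_in F K" "meets_all F K" by auto
    have "card L \<le> card K" if "matching_in F L" for L
    proof -
      have "card (L \<union> N) \<le> card (K \<union> N)"
        using up[OF K] matching_union(1)[OF N, of L] that by (simp add: F_def maximum_in_def)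
      then show ?thesis
        using matching_union(2)[OF N, of K] matching_union(2)[OF N, of L] K that
        by (simp add: F_def)
    qed
    with K show "maximum_in F K" by (simp add: maximum_in_def)
  qed
qed

text \<open>The matching \<open>K\<close> together with \<open>bc\<close> has one edge less than \<open>K\<close> together with \<open>ab\<close> and \<open>cd\<close>, so it is
not maximal. An edge that can be added contains \<open>a\<close> or \<open>d\<close>, and it is not \<open>ad\<close>.\<close>

lemma path_blocks:
  assumes equi: "equimatchable_edges E"
    and ab: "{a, b} \<in> E" and bc: "{b, c} \<in> E" and cd: "{c, d} \<in> E" and ad: "{a, d} \<notin> E"
    and dis: "distinct [a, b, c, d]"
    and K: "maximum_in {e \<in> E. e \<inter> {a, b, c, d} = {}} K"
  obtains i where "i \<notin> \<Union>K" "i \<notin> {a, b, c, d}" "{a, i} \<in> E \<or> {d, i} \<in> E"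
proof -
  let ?F = "{e \<in> E. e \<inter> {a, b, c, d} = {}}"
  let ?N = "{{a, b}, {c, d}}"
  interpret F: edge_family ?F by (rule subfamily) auto
  have N: "matching_in E ?N"
    using ab cd dis by (auto simp: matching_in_def disjoint_def)
  have UN: "\<Union>?N = {a, b, c, d}" by auto
  have mK: "matching_in ?F K" using K by (simp add: maximum_in_def)
  have KN: "maximum_in E (K \<union> ?N)"
    using delete_matched(2)[OF equi N, unfolded UN, OF K] .
  have "{a, b} \<noteq> {c, d}" using dis by (auto simp: doubleton_eq_iff)
  then have cKN: "card (K \<union> ?N) = card K + 2"
    using matching_union(2)[OF N, unfolded UN, OF mK] by simp
  have mKE: "matching_in E K" and "\<Union>K \<inter> {a, b, c, d} = {}"
    using mK by (auto simp: matching_in_def)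
  then have "{b, c} \<inter> \<Union>K = {}" by auto
  note ins = matching_insert[OF mKE bc this]
  have "\<not> meets_all E (insert {b, c} K)"
  proof
    assume "meets_all E (insert {b, c} K)"
    then have "maximum_in E (insert {b, c} K)"
      using equi ins by (simp add: equimatchable_edges_def)
    then have "card (K \<union> ?N) \<le> card (insert {b, c} K)"
      using KN unfolding maximum_in_def by blast
    then show False using cKN ins by simp
  qed
  then obtain e where e: "e \<in> E" "e \<inter> \<Union>K = {}" "b \<notin> e" "c \<notin> e"
    by (auto simp: meets_all_def)
  have "e \<inter> {a, b, c, d} \<noteq> {}"
    using F.maximum_meets_all[OF K] e by (auto simp: meets_all_def)
  then have "a \<in> e \<or> d \<in> e" using e by auto
  then obtain r i where r: "e = {r, i}" "r \<noteq> i" "r = a \<or> r = d"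
    using edge_ends[OF e(1)] by metis
  with e ad have "i \<notin> {a, b, c, d}" by (auto simp: insert_commute)
  with that r e show thesis by auto
qed

text \<open>By parity every maximum matching is perfect, but if \<open>a\<close> and \<open>d\<close> were nonadjacent, \<open>path_blocks\<close> would
yield one with a missed vertex.\<close>

lemma path_ends_adjacent_if_even:
  assumes equi: "equimatchable_edges E" and VE: "\<Union>E \<subseteq> V" and "finite V" and ev: "even (card V)"
    and one: "\<And>M p q. maximum_in E M \<Longrightarrow> p \<in> V - \<Union>M \<Longrightarrow> q \<in> V - \<Union>M \<Longrightarrow> p = q"
    and ab: "{a, b} \<in> E" and bc: "{b, c} \<in> E" and cd: "{c, d} \<in> E"
    and dis: "distinct [a, b, c, d]"
  shows "{a, d} \<in> E"
proof (rule ccontr)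
  assume ad: "{a, d} \<notin> E"
  let ?F = "{e \<in> E. e \<inter> {a, b, c, d} = {}}" and ?N = "{{a, b}, {c, d}}"
  have N: "matching_in E ?N" and UN: "\<Union>?N = {a, b, c, d}"
    using ab cd dis by (auto simp: matching_in_def disjoint_def)
  interpret F: edge_family ?F by (rule subfamily) auto
  obtain K where K: "maximum_in ?F K" by (rule F.exists_maximum)
  obtain i where i: "i \<notin> \<Union>K" "i \<notin> {a, b, c, d}" "{a, i} \<in> E \<or> {d, i} \<in> E"
    using path_blocks[OF equi ab bc cd ad dis K] .
  have M: "maximum_in E (K \<union> ?N)"
    using delete_matched(2)[OF equi N, unfolded UN, OF K] .
  then have mM: "matching_in E (K \<union> ?N)" by (simp add: maximum_in_def)
  have "\<Union>(K \<union> ?N) \<subseteq> V" using mM VE by (auto simp: matching_in_def)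
  then have "card (V - \<Union>(K \<union> ?N)) + 2 * card (K \<union> ?N) = card V"
    using card_covered[OF mM] \<open>finite V\<close>
    by (metis add.commute card_Diff_subset card_mono finite_subset le_add_diff_inverse)
  then have "even (card (V - \<Union>(K \<union> ?N)))" using ev by (metis dvd_triv_left even_add)
  moreover have iM: "i \<in> V - \<Union>(K \<union> ?N)" using i UN VE by auto
  have "V - \<Union>(K \<union> ?N) = {i}" using one[OF M _ iM] iM by blast
  ultimately show False by simp
qed

text \<open>The graph \<open>?F\<close> without the path is equimatchable, connected and odd, so by \<open>essential_independent\<close> one
end \<open>t\<close> of \<open>ij\<close> is missed by a maximum matching of \<open>?F\<close>. Adding \<open>ab\<close> and \<open>cd\<close> gives a maximum
matching of the whole graph that misses \<open>t\<close> only, but by \<open>path_blocks\<close> it also misses a neighbour of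
\<open>a\<close> or \<open>d\<close>.\<close>

lemma near_perfect_no_robust_path:
  assumes equi: "equimatchable_edges E" and VE: "\<Union>E \<subseteq> V" and fin: "finite V" and od: "odd (card V)"
    and one: "\<And>M p q. maximum_in E M \<Longrightarrow> p \<in> V - \<Union>M \<Longrightarrow> q \<in> V - \<Union>M \<Longrightarrow> p = q"
    and ab: "{a, b} \<in> E" and bc: "{b, c} \<in> E" and cd: "{c, d} \<in> E" and ad: "{a, d} \<notin> E"
    and dis: "distinct [a, b, c, d]"
    and conn: "\<And>p q. p \<in> V - {a, b, c, d} \<Longrightarrow> q \<in> V - {a, b, c, d} \<Longrightarrow>
      (p, q) \<in> (adj {e \<in> E. e \<inter> {a, b, c, d} = {}})\<^sup>*"
    and ij: "{i, j} \<in> E" "{i, j} \<inter> {a, b, c, d} = {}"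
    and far: "{a, i} \<notin> E" "{d, i} \<notin> E" "{a, j} \<notin> E" "{d, j} \<notin> E"
  shows False
proof -
  let ?D = "{a, b, c, d}" and ?N = "{{a, b}, {c, d}}"
  let ?F = "{e \<in> E. e \<inter> ?D = {}}"
  have N: "matching_in E ?N" and UN: "\<Union>?N = ?D"
    using ab cd dis by (auto simp: matching_in_def disjoint_def)
  interpret F: edge_family ?F by (rule subfamily) auto
  have equiF: "equimatchable_edges ?F"
    using delete_matched(1)[OF equi N, unfolded UN] .
  have DV: "?D \<subseteq> V" "card ?D = 4" using ab cd VE dis by auto
  obtain K where K: "maximum_in ?F K" by (rule F.exists_maximum)
  have mK: "matching_in ?F K" using K by (simp add: maximum_in_def)
  have dK: "\<Union>K \<subseteq> V" "\<Union>K \<inter> ?D = {}" using mK VE by (auto simp: matching_in_def)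
  have "card (\<Union>K \<union> ?D) = 2 * card K + 4"
    using card_Un_disjoint[OF F.finite_covered[OF mK] _ dK(2)] F.card_covered[OF mK] DV(2)
    by simp
  then have "\<Union>K \<union> ?D \<noteq> V" using od by auto
  then obtain s where s: "s \<in> V - ?D" "s \<notin> \<Union>K" using dK DV(1) by blast
  have ms: "missable ?F s" using K s by (auto simp: missable_def)
  have ijF: "{i, j} \<in> ?F" "{j, i} \<in> ?F" using ij by (auto simp: insert_commute)
  have ijV: "i \<in> V - ?D" "j \<in> V - ?D" using ij VE by auto
  have "missable ?F i \<or> missable ?F j"
    using F.essential_independent[OF equiF ms conn[OF s(1) ijV(1)]] ijF(2) by blast
  then obtain t where t: "t \<in> V - ?D" "{a, t} \<notin> E" "{d, t} \<notin> E" "missable ?F t"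
    using ijV far by blast
  then obtain L where L: "maximum_in ?F L" "t \<notin> \<Union>L" by (auto simp: missable_def)
  obtain k where k: "k \<notin> \<Union>L" "k \<notin> ?D" "{a, k} \<in> E \<or> {d, k} \<in> E"
    using path_blocks[OF equi ab bc cd ad dis L(1)] .
  have "maximum_in E (L \<union> ?N)"
    using delete_matched(2)[OF equi N, unfolded UN, OF L(1)] .
  moreover have "t \<in> V - \<Union>(L \<union> ?N)" "k \<in> V - \<Union>(L \<union> ?N)"
    using t(1) L(2) k VE by auto
  ultimately have "t = k" by (rule one)
  with t(2,3) k(3) show False by simp
qed

end

section \<open>Connected graphs and their independent sets\<close>

definition near :: "'a pair_pre_digraph \<Rightarrow> 'a \<Rightarrow> 'a \<Rightarrow> bool" where
  "near G u v \<longleftrightarrow> u = v \<or> (u, v) \<in> parcs G"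

lemma near_refl: "near G u u"
  by (simp add: near_def)

lemma near_if_arc: "(u, v) \<in> parcs G \<Longrightarrow> near G u v"
  by (simp add: near_def)

lemma not_near_neq: "\<not> near G u v \<Longrightarrow> u \<noteq> v"
  by (auto simp: near_def)

locale connected_graph = pair_graph G for G :: "'a pair_pre_digraph" +
  assumes nontriv: "nontrivial G" and conn: "Digraph_Component.connected (with_proj G)"
begin

lemma arc_sym: "(u, v) \<in> parcs G \<Longrightarrow> (v, u) \<in> parcs G"
  using arcs_symmetric by auto

lemma near_sym: "near G u v \<longleftrightarrow> near G v u"
  using arc_sym by (auto simp: near_def)

lemma arc_verts: "(u, v) \<in> parcs G \<Longrightarrow> u \<in> pverts G" "(u, v) \<in> parcs G \<Longrightarrow> v \<in> pverts G"
  using in_arcsD1 in_arcsD2 by auto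

lemma irrefl: "(u, u) \<notin> parcs G"
  using no_loops' by blast

lemma arc_neq: "(u, v) \<in> parcs G \<Longrightarrow> u \<noteq> v"
  using irrefl by blast

lemma reach:
  assumes "u \<in> pverts G" "v \<in> pverts G"
  shows "(u, v) \<in> (parcs G)\<^sup>*"
proof -
  have "u \<rightarrow>\<^sup>*\<^bsub>with_proj (mk_symmetric G)\<^esub> v"
    using conn assms by (auto simp: Digraph_Component.connected_def strongly_connected_def)
  moreover have "parcs (mk_symmetric G) \<subseteq> parcs G"
    using arc_sym by (auto simp: parcs_mk_symmetric)
  ultimately show ?thesis
    unfolding reachable_def by (auto dest!: rtrancl_on_rtranclI intro: rtrancl_mono[THEN subsetD])
qed

lemma verts_nonempty: "pverts G \<noteq> {}"
  using nontriv by (auto simp: nontrivial_def)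

lemma neighbour:
  assumes "u \<in> pverts G"
  obtains v where "(u, v) \<in> parcs G"
proof -
  have "pverts G \<noteq> {u}" using nontriv by (auto simp: nontrivial_def)
  then obtain w where "w \<in> pverts G" "w \<noteq> u" using assms by auto
  then show thesis using reach[OF assms] that by (metis converse_rtranclE)
qed

text \<open>A walk from \<open>u\<close> to \<open>v\<close> leaves the closed neighbourhood of \<open>u\<close>, and the first vertex \<open>z\<close> outside serves.\<close>

lemma distance_two:
  assumes "u \<in> pverts G" "v \<in> pverts G" "\<not> near G u v"
  obtains y z where "(u, y) \<in> parcs G" "(y, z) \<in> parcs G" "\<not> near G u z"
proof -
  have "near G u w" if no: "\<And>y z. (u, y) \<in> parcs G \<Longrightarrow> (y, z) \<in> parcs G \<Longrightarrow> near G u z"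
    and r: "(u, w) \<in> (parcs G)\<^sup>*" for w
    using r
  proof (induction rule: rtrancl_induct)
    case base
    show ?case by (rule near_refl)
  next
    case (step y z)
    then show ?case using no[of y z] by (auto simp: near_def)
  qed
  then show thesis using that reach[OF assms(1,2)] assms(3) by blast
qed

lemma independent_le: "independent_set G S \<Longrightarrow> card S \<le> independence_number G"
  and independent_exists: "\<exists>S. independent_set G S \<and> card S = independence_number G"
proof -
  let ?C = "{card S | S. independent_set G S}"
  have "?C \<subseteq> card ` Pow (pverts G)" by (auto simp: independent_set_def)
  then have fin: "finite ?C" using pair_finite_verts by (meson finite_Pow_iff finite_imageI finite_subset)
  show "card S \<le> independence_number G" if "independent_set G S"
    unfolding independence_number_def using fin that by (auto intro: Max_ge)
  have "independent_set G {}" by (simp add: independent_set_def)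
  then have "?C \<noteq> {}" by blast
  from Max_in[OF fin this] show "\<exists>S. independent_set G S \<and> card S = independence_number G"
    unfolding independence_number_def by auto
qed

lemma independence_number_pos: "independence_number G \<ge> 1"
proof -
  obtain v where "v \<in> pverts G" using verts_nonempty by auto
  then have "independent_set G {v}" using irrefl by (auto simp: independent_set_def)
  from independent_le[OF this] show ?thesis by simp
qed

lemma independent_subset:
  assumes "k \<le> independence_number G"
  obtains S where "S \<subseteq> pverts G" "card S = k" "\<And>u v. u \<in> S \<Longrightarrow> v \<in> S \<Longrightarrow> u \<noteq> v \<Longrightarrow> \<not> near G u v"
proof -
  obtain T where T: "independent_set G T" "card T = independence_number G"
    using independent_exists by blast
  with assms obtain S where S: "S \<subseteq> T" "card S = k" by (metis obtain_subset_with_card_n)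
  have "S \<subseteq> pverts G" using S T by (auto simp: independent_set_def)
  moreover have "\<not> near G u v" if "u \<in> S" "v \<in> S" "u \<noteq> v" for u v
    using that S(1) T(1) unfolding independent_set_def near_def by blast
  ultimately show thesis using that S(2) by blast
qed

lemma not_near_if_two:
  assumes "independence_number G \<ge> 2"
  obtains u v where "u \<in> pverts G" "v \<in> pverts G" "\<not> near G u v"
proof -
  obtain S where S: "S \<subseteq> pverts G" "card S = 2"
    "\<And>u v. u \<in> S \<Longrightarrow> v \<in> S \<Longrightarrow> u \<noteq> v \<Longrightarrow> \<not> near G u v"
    using independent_subset[OF assms] by metis
  obtain u v where "S = {u, v}" "u \<noteq> v" using S(2) by (auto simp: card_2_iff)
  then show thesis using that S by auto
qed

lemma near_if_one:
  assumes "independence_number G = 1" "u \<in> pverts G" "v \<in> pverts G"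
  shows "near G u v"
proof (rule ccontr)
  assume "\<not> near G u v"
  then have "u \<noteq> v" "independent_set G {u, v}"
    using assms arc_sym irrefl by (auto simp: near_def independent_set_def)
  then show False using independent_le assms(1) by fastforce
qed

text \<open>Suppose that the ends of every induced path on three vertices dominate the graph, and let \<open>p\<close>, \<open>q\<close>,
\<open>r\<close> be independent. A vertex \<open>z\<close> at distance two from \<open>p\<close> is then adjacent to both \<open>q\<close> and \<open>r\<close>, so
\<open>q - z - r\<close> is an induced path whose ends do not dominate \<open>p\<close>.\<close>

lemma induced_path_undominating:
  assumes "independence_number G \<ge> 3"
  obtains x y z i where "(x, y) \<in> parcs G" "(y, z) \<in> parcs G" "\<not> near G x z"
    "i \<in> pverts G" "\<not> near G x i" "\<not> near G z i"
proof (rule ccontr)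
  note witness = that
  assume none: "\<not> thesis"
  have dom: "near G x i \<or> near G z i"
    if path: "(x, y) \<in> parcs G" "(y, z) \<in> parcs G" "\<not> near G x z" "i \<in> pverts G" for x y z i
    using none witness[OF path] by blast
  obtain S where S: "S \<subseteq> pverts G" "card S = 3"
    "\<And>u v. u \<in> S \<Longrightarrow> v \<in> S \<Longrightarrow> u \<noteq> v \<Longrightarrow> \<not> near G u v"
    using independent_subset[OF assms] by metis
  obtain p q r where pqr: "S = {p, q, r}" "p \<noteq> q" "q \<noteq> r" "p \<noteq> r"
    using S(2) by (auto simp: card_3_iff)
  then have v: "p \<in> pverts G" "q \<in> pverts G" "r \<in> pverts G"
    and n: "\<not> near G p q" "\<not> near G p r" "\<not> near G q r" using S by auto
  obtain y z where yz: "(p, y) \<in> parcs G" "(y, z) \<in> parcs G" "\<not> near G p z"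
    using distance_two[OF v(1,2) n(1)] by metis
  have "near G z q" "near G z r" using dom[OF yz v(2)] dom[OF yz v(3)] n by auto
  then have "(q, z) \<in> parcs G" "(z, r) \<in> parcs G"
    using n near_sym arc_sym by (auto simp: near_def)
  from dom[OF this n(3) v(1)] show False using n near_sym by blast
qed

end

section \<open>Matchings of graphs as families of edges\<close>

lemma parcs_strong_product:
  "((g, h), (g', h')) \<in> parcs (strong_product G H) \<longleftrightarrow>
    (g, h) \<noteq> (g', h') \<and> g \<in> pverts G \<and> g' \<in> pverts G \<and> h \<in> pverts H \<and> h' \<in> pverts H \<and>
    near G g g' \<and> near H h h'"
  by (auto simp: strong_product_def closed_neighborhood_def near_def)

lemma edges_arc_iff:
  assumes "pair_graph G"
  shows "{u, v} \<in> edges G \<longleftrightarrow> (u, v) \<in> parcs G"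
proof -
  interpret pair_graph G by fact
  show ?thesis using arcs_symmetric by (auto simp: edges_def doubleton_eq_iff)
qed

lemma edge_family_edges:
  assumes "pair_graph G"
  shows "edge_family (edges G)" "\<Union>(edges G) \<subseteq> pverts G"
proof -
  interpret pair_graph G by fact
  have "edges G = (\<lambda>(u, v). {u, v}) ` parcs G" by (auto simp: edges_def)
  then have "finite (edges G)" using pair_finite_arcs by simp
  moreover have "card e = 2" if e: "e \<in> edges G" for e
  proof -
    obtain u v where "e = {u, v}" "(u, v) \<in> parcs G" using e by (auto simp: edges_def)
    then show ?thesis using no_loops'[of u v] by simp
  qed
  ultimately show "edge_family (edges G)" by unfold_locales
  show "\<Union>(edges G) \<subseteq> pverts G"
    using in_arcsD1 in_arcsD2 by (auto simp: edges_def)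
qed

lemma matching_iff: "matching G M \<longleftrightarrow> matching_in (edges G) M"
  by (auto simp: matching_def matching_in_def disjoint_def)

lemma maximum_matching_iff: "maximum_matching G M \<longleftrightarrow> maximum_in (edges G) M"
  by (simp add: maximum_matching_def maximum_in_def matching_iff)

lemma maximal_matching_iff:
  assumes "pair_graph G"
  shows "maximal_matching G M \<longleftrightarrow> matching_in (edges G) M \<and> meets_all (edges G) M"
proof -
  interpret edge_family "edges G" by (rule edge_family_edges[OF assms])
  show ?thesis
  proof (intro iffI conjI)
    assume M: "maximal_matching G M"
    then show m: "matching_in (edges G) M" by (simp add: maximal_matching_def matching_iff)
    show "meets_all (edges G) M"
      unfolding meets_all_def
    proof (intro ballI notI)
      fix e assume e: "e \<in> edges G" "e \<inter> \<Union>M = {}"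
      from matching_insert[OF m e] have "matching G (insert e M)" "M \<noteq> insert e M"
        by (auto simp: matching_iff)
      with M show False unfolding maximal_matching_def by blast
    qed
  next
    assume M: "matching_in (edges G) M \<and> meets_all (edges G) M"
    have False if K: "matching G K" "M \<subset> K" for K
    proof -
      obtain e where e: "e \<in> K" "e \<notin> M" using K(2) by blast
      then have "e \<in> edges G" using K(1) by (auto simp: matching_def)
      then obtain f where "f \<in> M" "e \<inter> f \<noteq> {}" using M unfolding meets_all_def by blast
      moreover have "f \<in> K" "e \<noteq> f" using calculation e K(2) by auto
      ultimately show False using K(1) e(1) unfolding matching_def by blast
    qed
    with M show "maximal_matching G M" by (auto simp: maximal_matching_def matching_iff)
  qed
qed

lemma equimatchable_iff:
  "pair_graph G \<Longrightarrow> equimatchable G \<longleftrightarrow> equimatchable_edges (edges G)"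
  by (simp add: equimatchable_def equimatchable_edges_def maximal_matching_iff maximum_matching_iff)

lemma edges_strong_product_swap:
  "edges (strong_product H G) = image prod.swap ` edges (strong_product G H)"
proof -
  have *: "image prod.swap ` edges (strong_product G H) \<subseteq> edges (strong_product H G)"
    for G :: "'c pair_pre_digraph" and H :: "'d pair_pre_digraph"
  proof
    fix e assume "e \<in> image prod.swap ` edges (strong_product G H)"
    then obtain g h g' h' where "e = {(h, g), (h', g')}"
      "((g, h), (g', h')) \<in> parcs (strong_product G H)"
      by (auto simp: edges_def)
    then show "e \<in> edges (strong_product H G)"
      unfolding edges_def
      using parcs_strong_product[of g h g' h' G H] parcs_strong_product[of h g h' g' H G] by auto
  qed
  have "image prod.swap ` image prod.swap ` edges (strong_product H G) = edges (strong_product H G)"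
    by (simp add: image_image)
  with *[of G H] *[of H G] show ?thesis by (metis image_mono subset_antisym)
qed

lemma equimatchable_edges_image:
  assumes inj: "inj f" and equi: "equimatchable_edges E"
  shows "equimatchable_edges (image f ` E)"
proof -
  have injf: "inj (image f)"
    using inj by (intro injI) (simp add: inj_image_eq_iff)
  have m: "matching_in (image f ` E) (image f ` M) \<longleftrightarrow> matching_in E M" for M
  proof -
    have "image f ` M \<subseteq> image f ` E \<longleftrightarrow> M \<subseteq> E"
      by (rule inj_image_subset_iff[OF injf])
    moreover have "disjoint (image f ` M) \<longleftrightarrow> disjoint M"
      using inj by (auto simp: disjoint_def image_Int[symmetric] inj_image_eq_iff)
    ultimately show ?thesis by (simp add: matching_in_def)
  qed
  have c: "card (image f ` M) = card M" for M
    using injf by (intro card_image) (rule inj_on_subset, auto)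
  have pre: "\<exists>M. K = image f ` M" if "matching_in (image f ` E) K" for K
    using that by (auto simp: matching_in_def subset_image_iff)
  have a: "meets_all (image f ` E) (image f ` M) \<longleftrightarrow> meets_all E M" for M
  proof -
    have "f ` e \<inter> \<Union>(image f ` M) = f ` (e \<inter> \<Union>M)" for e
      using inj by (metis image_Int image_Union)
    then show ?thesis by (simp add: meets_all_def)
  qed
  have "maximum_in (image f ` E) (image f ` M) \<longleftrightarrow> maximum_in E M" for M
    unfolding maximum_in_def using m c pre by metis
  then show ?thesis
    using equi m a pre unfolding equimatchable_edges_def by metis
qed

text \<open>The results on products below treat the two factors asymmetrically; this exchanges their roles.\<close>

lemma equimatchable_strong_product_commute:
  assumes "pair_graph G" "pair_graph H"
  shows "equimatchable (strong_product G H) \<longleftrightarrow> equimatchable (strong_product H G)"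
proof -
  have "inj (prod.swap :: 'x \<times> 'y \<Rightarrow> _)" by (simp add: inj_swap)
  then show ?thesis
    using assms equimatchable_edges_image edges_strong_product_swap
    by (metis equimatchable_iff inj_swap pair_graph_strong_product)
qed

section \<open>Connectedness in strong products\<close>

locale two_connected_graphs = G: connected_graph G + H: connected_graph H
  for G :: "'a pair_pre_digraph" and H :: "'b pair_pre_digraph"
begin

abbreviation product_edges :: "('a \<times> 'b) set set" where
  "product_edges \<equiv> edges (strong_product G H)"

abbreviation product_verts :: "('a \<times> 'b) set" where
  "product_verts \<equiv> pverts G \<times> pverts H"

lemma product_graph: "pair_graph (strong_product G H)"
  by (rule pair_graph_strong_product[OF G.pair_graph H.pair_graph])

lemma edge_iff:
  "{(g, h), (g', h')} \<in> product_edges \<longleftrightarrow>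
    (g, h) \<noteq> (g', h') \<and> g \<in> pverts G \<and> g' \<in> pverts G \<and> h \<in> pverts H \<and> h' \<in> pverts H \<and>
    near G g g' \<and> near H h h'"
  unfolding edges_arc_iff[OF product_graph] parcs_strong_product ..

sublocale P: edge_family product_edges
  by (rule edge_family_edges(1)[OF product_graph])

lemma Union_product_edges: "\<Union>product_edges \<subseteq> product_verts"
  using edge_family_edges(2)[OF product_graph] by (simp add: strong_product_def)

lemma product_connected:
  assumes "p \<in> product_verts" "q \<in> product_verts"
  shows "(p, q) \<in> (adj product_edges)\<^sup>*"
proof -
  obtain g h g' h' where pq: "p = (g, h)" "q = (g', h')" by (cases p, cases q)
  have v: "g \<in> pverts G" "g' \<in> pverts G" "h \<in> pverts H" "h' \<in> pverts H"
    using assms pq by auto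
  have row: "((g, h), (k, h)) \<in> (adj product_edges)\<^sup>*" if "(g, k) \<in> (parcs G)\<^sup>*" for k
    using that
  proof (induction rule: rtrancl_induct)
    case base
    show ?case by simp
  next
    case (step k l)
    then have "((k, h), (l, h)) \<in> adj product_edges"
      using G.arc_neq G.arc_verts v by (auto simp: adj_def edge_iff near_def)
    with step.IH show ?case by (rule rtrancl_into_rtrancl)
  qed
  have column: "((g', h), (g', k)) \<in> (adj product_edges)\<^sup>*" if "(h, k) \<in> (parcs H)\<^sup>*" for k
    using that
  proof (induction rule: rtrancl_induct)
    case base
    show ?case by simp
  next
    case (step k l)
    then have "((g', k), (g', l)) \<in> adj product_edges"
      using H.arc_neq H.arc_verts v by (auto simp: adj_def edge_iff near_def)
    with step.IH show ?case by (rule rtrancl_into_rtrancl)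
  qed
  show ?thesis
    unfolding pq by (rule rtrancl_trans[OF row[OF G.reach] column[OF H.reach]]) (fact v)+
qed

text \<open>Fix neighbours \<open>y'\<close> of \<open>y\<close> and \<open>k'\<close> of \<open>k\<close>. Every neighbour of \<open>w = (y, k)\<close> is joined to \<open>(y', k')\<close>
within the neighbourhood of \<open>w\<close>, via the axis vertices \<open>(g, k)\<close> and \<open>(y, k')\<close>.\<close>

lemma product_locally_connected:
  assumes p: "{p, w} \<in> product_edges" and q: "{q, w} \<in> product_edges"
  shows "(p, q) \<in> {(u, v). {u, v} \<in> product_edges \<and> {u, w} \<in> product_edges \<and> {v, w} \<in> product_edges}\<^sup>*"
    (is "_ \<in> ?R\<^sup>*")
proof -
  obtain y k where w: "w = (y, k)" by (cases w)
  have "w \<in> product_verts" using p Union_product_edges by auto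
  then have yk: "y \<in> pverts G" "k \<in> pverts H" using w by auto
  obtain y' where y': "(y, y') \<in> parcs G" using G.neighbour[OF yk(1)] .
  obtain k' where k': "(k, k') \<in> parcs H" using H.neighbour[OF yk(2)] .
  have ne: "y' \<noteq> y" "k' \<noteq> k" using y' k' G.irrefl H.irrefl by auto
  note nb = y' k' G.arc_sym[OF y'] H.arc_sym[OF k'] G.arc_verts[OF y'] H.arc_verts[OF k'] ne
  have symR: "sym ?R" by (auto simp: sym_def insert_commute)
  have hub: "(r, (y', k')) \<in> ?R\<^sup>*" if r: "{r, w} \<in> product_edges" for r
  proof -
    obtain g h where gh: "r = (g, h)" by (cases r)
    have e: "(g, h) \<noteq> (y, k)" "g \<in> pverts G" "h \<in> pverts H" "near G g y" "near H h k"
      using r unfolding w gh edge_iff by auto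
    show ?thesis
    proof (cases "g = y")
      case True
      then have "((g, h), (y', k)) \<in> ?R" "((y', k), (y, k')) \<in> ?R" "((y, k'), (y', k')) \<in> ?R"
        using e nb unfolding w by (auto simp: edge_iff near_def)
      then show ?thesis unfolding gh by (meson converse_rtrancl_into_rtrancl r_into_rtrancl)
    next
      case False
      have "((g, h), (g, k)) \<in> ?R\<^sup>*"
      proof (cases "h = k")
        case False
        then have "((g, h), (g, k)) \<in> ?R"
          using e \<open>g \<noteq> y\<close> yk unfolding w by (auto simp: edge_iff near_def)
        then show ?thesis by blast
      qed simp
      moreover have "((g, k), (y, k')) \<in> ?R" "((y, k'), (y', k')) \<in> ?R"
        using e \<open>g \<noteq> y\<close> nb unfolding w by (auto simp: edge_iff near_def)
      ultimately show ?thesis unfolding gh by (meson rtrancl_into_rtrancl)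
    qed
  qed
  have "((y', k'), q) \<in> ?R\<^sup>*"
    using hub[OF q] sym_rtrancl[OF symR] by (auto dest: symD)
  with hub[OF p] show ?thesis by (rule rtrancl_trans)
qed

lemma product_misses_at_most_one:
  assumes "equimatchable_edges product_edges" "maximum_in product_edges M"
    "p \<in> product_verts - \<Union>M" "q \<in> product_verts - \<Union>M"
  shows "p = q"
  using P.misses_at_most_one[OF assms(1) Union_product_edges product_connected
      product_locally_connected assms(2-4)] .

text \<open>This shape of path is chosen because its two ends lie in the same row and because removing it does not
disconnect the product if \<open>H\<close> has a third vertex: the row of \<open>u\<close> keeps \<open>(y, u)\<close> and the row of \<open>k\<close> keeps \<open>(z, k)\<close>.\<close>

lemma product_path:
  assumes "(x, y) \<in> parcs G" "(y, z) \<in> parcs G" "\<not> near G x z" "(u, k) \<in> parcs H"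
  shows "{(x, u), (x, k)} \<in> product_edges" "{(x, k), (y, k)} \<in> product_edges"
    "{(y, k), (z, u)} \<in> product_edges" "{(x, u), (z, u)} \<notin> product_edges"
    "distinct [(x, u), (x, k), (y, k), (z, u)]"
proof -
  have "x \<noteq> y" "y \<noteq> z" "x \<noteq> z" "u \<noteq> k"
    using assms(1,2)[THEN G.arc_neq] assms(4)[THEN H.arc_neq] assms(3)[THEN not_near_neq] by simp_all
  moreover have "near G x y" "near G y z" "near H u k" "near H k u"
    using assms H.arc_sym[OF assms(4)] by (simp_all add: near_def)
  ultimately show "{(x, u), (x, k)} \<in> product_edges" "{(x, k), (y, k)} \<in> product_edges"
    "{(y, k), (z, u)} \<in> product_edges" "{(x, u), (z, u)} \<notin> product_edges"
    "distinct [(x, u), (x, k), (y, k), (z, u)]"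
    using assms(3) G.arc_verts[OF assms(1)] G.arc_verts[OF assms(2)] H.arc_verts[OF assms(4)]
    by (simp_all add: edge_iff near_refl)
qed

text \<open>The column of \<open>y\<close>, with the removed vertex \<open>(y, k)\<close> replaced by \<open>(z, k)\<close>, is a homomorphic copy of \<open>H\<close>
that survives the removal. Each remaining vertex in the columns of \<open>x\<close>, \<open>y\<close> and \<open>z\<close> belongs to this
copy or is adjacent to it. All other columns are intact, and they are reached along the row of \<open>h0\<close>,
from which nothing is removed.\<close>

lemma product_minus_path_connected:
  assumes xy: "(x, y) \<in> parcs G" and yz: "(y, z) \<in> parcs G" and xz: "\<not> near G x z"
    and uk: "(u, k) \<in> parcs H" and h0: "h0 \<in> pverts H" "h0 \<noteq> u" "h0 \<noteq> k"
  defines "D \<equiv> {(x, u), (x, k), (y, k), (z, u)}"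
  assumes p: "p \<in> product_verts - D" and q: "q \<in> product_verts - D"
  shows "(p, q) \<in> (adj {e \<in> product_edges. e \<inter> D = {}})\<^sup>*" (is "_ \<in> (adj ?F)\<^sup>*")
proof -
  have v: "x \<in> pverts G" "y \<in> pverts G" "z \<in> pverts G" "u \<in> pverts H" "k \<in> pverts H"
    using G.arc_verts[OF xy] G.arc_verts[OF yz] H.arc_verts[OF uk] by auto
  have ne: "x \<noteq> y" "y \<noteq> z" "x \<noteq> z" "u \<noteq> k"
    using G.arc_neq[OF xy] G.arc_neq[OF yz] not_near_neq[OF xz] H.arc_neq[OF uk] by simp_all
  note s = G.arc_sym[OF xy] G.arc_sym[OF yz] H.arc_sym[OF uk]
  define R where "R p \<longleftrightarrow> p \<in> product_verts - D \<and> ((y, h0), p) \<in> (adj ?F)\<^sup>*" for p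
  have walk: "R (g', h')" if "R (g, h)" "near G g g'" "near H h h'" "g' \<in> pverts G" "h' \<in> pverts H"
    "(g', h') \<notin> D" for g h g' h'
  proof (cases "(g, h) = (g', h')")
    case False
    then have "((g, h), (g', h')) \<in> adj ?F"
      using that by (auto simp: adj_def edge_iff R_def)
    then show ?thesis using that unfolding R_def by (auto intro: rtrancl_into_rtrancl)
  qed (use that in simp)
  have root: "R (y, h0)" using v h0 ne by (auto simp: R_def D_def)
  \<comment> \<open>The surviving copy of \<open>H\<close> is the graph of \<open>f\<close>.\<close>
  define f where "f h = (if h = k then z else y)" for h
  have spine: "R (f h, h)" if "(h0, h) \<in> (parcs H)\<^sup>*" for h
    using that
  proof (induction rule: rtrancl_induct)
    case base
    show ?case using root h0 by (simp add: f_def)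
  next
    case (step h h')
    have "near G (f h) (f h')" using yz s by (auto simp: f_def near_def)
    moreover have "f h' \<in> pverts G" "(f h', h') \<notin> D" using v ne by (auto simp: f_def D_def)
    ultimately show ?case
      using walk[OF step.IH, of "f h'" h'] near_if_arc[OF step.hyps(2)]
        H.arc_verts(2)[OF step.hyps(2)] by simp
  qed
  have spine': "R (f h, h)" if "h \<in> pverts H" for h
    using spine H.reach[OF h0(1) that] .
  have near_path: "R (g, h)" if "g \<in> {x, y, z}" "h \<in> pverts H" "(g, h) \<notin> D" for g h
  proof (cases "g = f h")
    case True
    then show ?thesis using spine'[OF that(2)] by simp
  next
    case False
    then have "near G (f h) g" using that xy yz s by (auto simp: f_def near_def D_def split: if_splits)
    moreover have "g \<in> pverts G" using that v by auto
    ultimately show ?thesis using walk[OF spine'[OF that(2)], of g h] that by (simp add: near_refl)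
  qed
  have col: "\<forall>h\<in>pverts H. (g, h) \<notin> D \<longrightarrow> R (g, h)" if "(y, g) \<in> (parcs G)\<^sup>*" for g
    using that
  proof (induction rule: rtrancl_induct)
    case base
    show ?case using near_path by simp
  next
    case (step g g')
    show ?case
    proof (cases "g' \<in> {x, y, z}")
      case True
      then show ?thesis using near_path by blast
    next
      case False
      then have out: "(g', h) \<notin> D" for h by (auto simp: D_def)
      have g': "g' \<in> pverts G" "near G g g'"
        using step.hyps G.arc_verts by (auto simp: near_def)
      have "R (g, h0)" using step.IH h0 by (auto simp: D_def)
      then have base: "R (g', h0)"
        using walk[of g h0 g' h0] g' out h0 by (simp add: near_refl)
      have "R (g', h)" if "(h0, h) \<in> (parcs H)\<^sup>*" for h
        using that
      proof (induction rule: rtrancl_induct)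
        case base
        show ?case by fact
      next
        case (step h h')
        then show ?case
          using walk[OF step.IH, of g' h'] g'(1) out near_if_arc[OF step.hyps(2)]
            H.arc_verts(2)[OF step.hyps(2)] by (simp add: near_refl)
      qed
      then show ?thesis using H.reach h0 by blast
    qed
  qed
  have all: "((y, h0), r) \<in> (adj ?F)\<^sup>*" if "r \<in> product_verts - D" for r
    using that col G.reach[OF v(2), of "fst r"] by (cases r) (auto simp: R_def)
  have "(p, (y, h0)) \<in> (adj ?F)\<^sup>*"
    by (rule symD[OF sym_rtrancl[OF sym_adj] all[OF p]])
  then show ?thesis using all[OF q] by (rule rtrancl_trans)
qed

section \<open>Equimatchable strong products\<close>

lemma finite_product_verts: "finite product_verts"
  using G.pair_finite_verts H.pair_finite_verts by simp

lemma complete_if_equimatchable_even: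
  assumes equi: "equimatchable_edges product_edges" and ev: "even (card product_verts)"
  shows "independence_number G < 2"
proof (rule ccontr)
  assume "\<not> independence_number G < 2"
  then obtain s t where "s \<in> pverts G" "t \<in> pverts G" "\<not> near G s t"
    using G.not_near_if_two by (metis not_less)
  then obtain y z where xyz: "(s, y) \<in> parcs G" "(y, z) \<in> parcs G" "\<not> near G s z"
    using G.distance_two by metis
  obtain u where "u \<in> pverts H" using H.verts_nonempty by blast
  then obtain k where uk: "(u, k) \<in> parcs H" using H.neighbour by metis
  note path = product_path[OF xyz uk]
  have "{(s, u), (z, u)} \<in> product_edges"
    by (rule P.path_ends_adjacent_if_even[OF equi Union_product_edges finite_product_verts ev
          _ path(1-3,5)]) (erule (2) product_misses_at_most_one[OF equi])
  with path(4) show False by simp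
qed

lemma no_remote_edge:
  assumes equi: "equimatchable_edges product_edges" and od: "odd (card product_verts)"
    and xyz: "(x, y) \<in> parcs G" "(y, z) \<in> parcs G" "\<not> near G x z" and uk: "(u, k) \<in> parcs H"
    and h0: "h0 \<in> pverts H" "h0 \<noteq> u" "h0 \<noteq> k"
    and ij: "{i, j} \<in> product_edges" "{i, j} \<inter> {(x, u), (x, k), (y, k), (z, u)} = {}"
    and far: "{(x, u), i} \<notin> product_edges" "{(z, u), i} \<notin> product_edges"
      "{(x, u), j} \<notin> product_edges" "{(z, u), j} \<notin> product_edges"
  shows False
  by (rule P.near_perfect_no_robust_path[OF equi Union_product_edges finite_product_verts od
        _ product_path[OF xyz uk] _ ij far])
    (erule (2) product_misses_at_most_one[OF equi],
      erule (1) product_minus_path_connected[OF xyz uk h0])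

text \<open>With \<open>u\<close> and \<open>h0\<close> nonadjacent in \<open>H\<close>, no vertex in the row of \<open>h0\<close> is adjacent to a vertex in the row
of \<open>u\<close>, which contains both ends of the path.\<close>

lemma not_both_incomplete:
  assumes equi: "equimatchable_edges product_edges" and od: "odd (card product_verts)"
    and G2: "independence_number G \<ge> 2"
  shows "independence_number H < 2"
proof (rule ccontr)
  assume "\<not> independence_number H < 2"
  then obtain u h0 where u: "u \<in> pverts H" "h0 \<in> pverts H" "\<not> near H u h0"
    using H.not_near_if_two by (metis not_less)
  obtain k where uk: "(u, k) \<in> parcs H" using H.neighbour[OF u(1)] .
  have h0: "h0 \<noteq> u" "h0 \<noteq> k" using u(3) uk by (auto simp: near_def)
  obtain s t where "s \<in> pverts G" "t \<in> pverts G" "\<not> near G s t"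
    using G.not_near_if_two[OF G2] .
  then obtain y z where xyz: "(s, y) \<in> parcs G" "(y, z) \<in> parcs G" "\<not> near G s z"
    using G.distance_two by metis
  have "{(s, h0), (y, h0)} \<in> product_edges"
    using xyz(1) G.arc_neq[OF xyz(1)] G.arc_verts[OF xyz(1)] u(2)
    by (simp add: edge_iff near_refl near_if_arc)
  then show False
    by (rule no_remote_edge[OF equi od xyz uk u(2) h0]) (use h0 u(3) in \<open>simp_all add: edge_iff\<close>)
qed

text \<open>If \<open>i\<close> is adjacent to neither end of an induced path \<open>x - y - z\<close>, then the column of \<open>i\<close> is far from
\<open>(x, u)\<close> and \<open>(z, u)\<close>. Oddness of the product provides the third vertex \<open>h0\<close> of \<open>H\<close>.\<close>

lemma independence_number_less_three:
  assumes equi: "equimatchable_edges product_edges" and od: "odd (card product_verts)"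
  shows "independence_number G < 3"
proof (rule ccontr)
  assume "\<not> independence_number G < 3"
  then obtain x y z i where xyz: "(x, y) \<in> parcs G" "(y, z) \<in> parcs G" "\<not> near G x z"
    and i: "i \<in> pverts G" "\<not> near G x i" "\<not> near G z i"
    using G.induced_path_undominating by (metis not_less)
  obtain u where "u \<in> pverts H" using H.verts_nonempty by blast
  then obtain k where uk: "(u, k) \<in> parcs H" using H.neighbour by metis
  have "card (pverts H) \<noteq> 2"
    using od by (auto simp: card_cartesian_product)
  then have "pverts H \<noteq> {u, k}" using H.arc_neq[OF uk] by auto
  then obtain h0 where h0: "h0 \<in> pverts H" "h0 \<noteq> u" "h0 \<noteq> k"
    using H.arc_verts[OF uk] by blast
  have "i \<noteq> x" "i \<noteq> z" "i \<noteq> y"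
    using i xyz G.arc_sym[OF xyz(2)] by (auto simp: near_def)
  moreover have "{(i, u), (i, k)} \<in> product_edges"
    using uk H.arc_neq[OF uk] H.arc_verts[OF uk] i(1) by (simp add: edge_iff near_refl near_if_arc)
  ultimately show False
    by (intro no_remote_edge[OF equi od xyz uk h0, of "(i, u)" "(i, k)"])
      (use i in \<open>simp_all add: edge_iff\<close>)
qed

text \<open>Two unmatched vertices cannot have adjacent or equal second coordinates, because \<open>G\<close> is complete. So
the projection to \<open>H\<close> bounds the number of unmatched vertices, and parity excludes two of them when
the product is odd.\<close>

lemma equimatchable_if_complete_factor:
  assumes G1: "independence_number G = 1"
    and H: "independence_number H = 1 \<or> independence_number H = 2 \<and> odd (card product_verts)"
  shows "equimatchable_edges product_edges"
  unfolding equimatchable_edges_def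
proof (intro allI impI)
  fix M assume "matching_in product_edges M \<and> meets_all product_edges M"
  then have M: "matching_in product_edges M" "meets_all product_edges M" by auto
  let ?U = "product_verts - \<Union>M"
  have apart: "\<not> near H h h'" if "(g, h) \<in> ?U" "(g', h') \<in> ?U" "(g, h) \<noteq> (g', h')" for g h g' h'
  proof
    assume "near H h h'"
    then have "{(g, h), (g', h')} \<in> product_edges"
      using that G.near_if_one[OF G1] by (simp add: edge_iff)
    with M(2) that show False by (auto simp: meets_all_def)
  qed
  have "inj_on snd ?U"
  proof (rule inj_onI)
    fix p q assume "p \<in> ?U" "q \<in> ?U" "snd p = snd q"
    then show "p = q"
      using apart[of "fst p" "snd p" "fst q" "snd q"] near_refl[of H "snd p"]
      by (metis prod.collapse)
  qed
  then have "card ?U = card (snd ` ?U)" by (simp add: card_image)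
  also have "independent_set H (snd ` ?U)"
    unfolding independent_set_def
  proof (intro conjI ballI notI)
    show "snd ` ?U \<subseteq> pverts H" by auto
  next
    fix h h' assume "h \<in> snd ` ?U" "h' \<in> snd ` ?U" and hh: "(h, h') \<in> parcs H"
    then obtain g g' where "(g, h) \<in> ?U" "(g', h') \<in> ?U" by force
    then show False
      using apart[of g h g' h'] near_if_arc[OF hh] H.arc_neq[OF hh] by simp
  qed
  then have "card (snd ` ?U) \<le> independence_number H" by (rule H.independent_le)
  finally have U: "card ?U \<le> independence_number H" .
  have sub: "\<Union>K \<subseteq> product_verts" if "matching_in product_edges K" for K
    using that Union_product_edges by (auto simp: matching_in_def)
  have "card ?U + card (\<Union>M) = card product_verts"
    using sub[OF M(1)] finite_product_verts
    by (metis add.commute card_Diff_subset card_mono finite_subset le_add_diff_inverse)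
  then have total: "card ?U + 2 * card M = card product_verts"
    using P.card_covered[OF M(1)] by simp
  have "card ?U \<le> 1"
  proof (rule ccontr)
    assume "\<not> card ?U \<le> 1"
    with U H have "card ?U = 2" "odd (card product_verts)" by linarith+
    with total show False by (metis dvd_triv_left even_add even_numeral)
  qed
  have "card K \<le> card M" if K: "matching_in product_edges K" for K
  proof -
    have "2 * card K \<le> card product_verts"
      using card_mono[OF finite_product_verts sub[OF K]] P.card_covered[OF K] by simp
    with total \<open>card ?U \<le> 1\<close> show ?thesis by linarith
  qed
  with M(1) show "maximum_in product_edges M" by (simp add: maximum_in_def)
qed

end

theorem theorem1p3:
  fixes G :: "'a pair_pre_digraph" and H :: "'b pair_pre_digraph"
  assumes "pair_graph G" and "pair_graph H"
    and "nontrivial G" and "nontrivial H"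
    and "Digraph_Component.connected (with_proj G)"
    and "Digraph_Component.connected (with_proj H)"
  shows "(even_graph G \<or> even_graph H \<longrightarrow>
            (equimatchable (strong_product G H) \<longleftrightarrow>
               independence_number G + independence_number H = 2)) \<and>
         (odd_graph G \<and> odd_graph H \<longrightarrow>
            (equimatchable (strong_product G H) \<longleftrightarrow>
               independence_number G + independence_number H \<le> 3))"
proof -
  interpret two_connected_graphs G H
    using assms by (intro two_connected_graphs.intro connected_graph.intro connected_graph_axioms.intro)
  interpret swapped: two_connected_graphs H G
    by (intro two_connected_graphs.intro G.connected_graph_axioms H.connected_graph_axioms)
  let ?a = "independence_number G" and ?b = "independence_number H"
  have eq: "equimatchable (strong_product G H) \<longleftrightarrow> equimatchable_edges product_edges"
    by (rule equimatchable_iff[OF product_graph])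
  have eq': "equimatchable (strong_product G H) \<longleftrightarrow> equimatchable_edges swapped.product_edges"
    using equimatchable_strong_product_commute[OF assms(1,2)] equimatchable_iff[OF swapped.product_graph]
    by simp
  have pos: "?a \<ge> 1" "?b \<ge> 1"
    by (rule G.independence_number_pos, rule H.independence_number_pos)
  have card: "card product_verts = card (pverts G) * card (pverts H)"
    "card swapped.product_verts = card (pverts G) * card (pverts H)"
    by (simp_all add: card_cartesian_product)
  show ?thesis
  proof (intro conjI impI)
    assume "even_graph G \<or> even_graph H"
    then have ev: "even (card product_verts)" "even (card swapped.product_verts)"
      unfolding card even_graph_def by auto
    show "equimatchable (strong_product G H) \<longleftrightarrow> ?a + ?b = 2"
    proof
      assume "equimatchable (strong_product G H)"
      then show "?a + ?b = 2"
        using complete_if_equimatchable_even[OF _ ev(1)]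
          swapped.complete_if_equimatchable_even[OF _ ev(2)] eq eq' pos by simp
    next
      assume "?a + ?b = 2"
      with pos have "?a = 1" "?b = 1" by linarith+
      then show "equimatchable (strong_product G H)"
        using equimatchable_if_complete_factor eq by blast
    qed
  next
    assume "odd_graph G \<and> odd_graph H"
    then have od: "odd (card product_verts)" "odd (card swapped.product_verts)"
      unfolding card odd_graph_def by auto
    show "equimatchable (strong_product G H) \<longleftrightarrow> ?a + ?b \<le> 3"
    proof
      assume e: "equimatchable (strong_product G H)"
      have "?a < 3" "?b < 3" "\<not> (?a \<ge> 2 \<and> ?b \<ge> 2)"
        using e eq eq' independence_number_less_three[OF _ od(1)]
          swapped.independence_number_less_three[OF _ od(2)] not_both_incomplete[OF _ od(1)]
        by auto
      then show "?a + ?b \<le> 3" by linarith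
    next
      assume "?a + ?b \<le> 3"
      with pos consider "?a = 1" "?b = 1 \<or> ?b = 2" | "?b = 1" "?a = 1 \<or> ?a = 2" by linarith
      then show "equimatchable (strong_product G H)"
        using equimatchable_if_complete_factor swapped.equimatchable_if_complete_factor od eq eq'
        by cases blast+
    qed
  qed
qed

end
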